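(* For each $p\in[1,\infty)$, the continuous inclusion $\mathscr{M}(d_p)\subseteq\ell^1$ holds.
   Context: Let $\mathbb{N}_0=\{0,1,2,\dots\}$ and $\ell^1=\ell^1(\mathbb{N}_0)$ (complex sequences). For $p\in[1,\infty)$, $d_p$ is the Banach space of all complex sequences $a=(a_n)_{n=0}^\infty$ with $\|a\|_{d_p}:=\big(\sum_{n=0}^\infty\sup_{k\ge n}|a_k|^p\big)^{1/p}<\infty$. The convolution of $a,b\in\mathbb{C}^{\mathbb{N}_0}$ is $(a*b)_n:=\sum_{j=0}^n a_jb_{n-j}$, $n\in\mathbb{N}_0$. The multiplier algebra of $d_p$ is $\mathscr{M}(d_p):=\{b\in\mathbb{C}^{\mathbb{N}_0}: a*b\in d_p \text{ for all } a\in d_p\}$, normed by $\|b\|_{\mathscr{M}(d_p)}:=\sup_{0\ne a\in d_p}\|a*b\|_{d_p}/\|a\|_{d_p}$ (which is finite for each $b\in\mathscr{M}(d_p)$). *)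

theory Defs
  imports "HOL-Analysis.Analysis"
begin

text \<open>The \<open>p\<close>-th power of the norm of \<open>d\<^sub>p\<close>, with values in \<open>[0, \<infinity>]\<close>.\<close>

definition dp_sum :: "real \<Rightarrow> (nat \<Rightarrow> complex) \<Rightarrow> ennreal" where
  "dp_sum p a = (\<Sum>n. SUP k\<in>{n..}. ennreal (cmod (a k) powr p))"

definition dp :: "real \<Rightarrow> (nat \<Rightarrow> complex) set" where
  "dp p = {a. dp_sum p a < \<infinity>}"

definition dp_norm :: "real \<Rightarrow> (nat \<Rightarrow> complex) \<Rightarrow> real" where
  "dp_norm p a = enn2real (dp_sum p a) powr (1 / p)"

definition seq_conv :: "(nat \<Rightarrow> complex) \<Rightarrow> (nat \<Rightarrow> complex) \<Rightarrow> nat \<Rightarrow> complex" where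
  "seq_conv a b n = (\<Sum>j=0..n. a j * b (n - j))"

definition dp_mult :: "real \<Rightarrow> (nat \<Rightarrow> complex) set" where
  "dp_mult p = {b. \<forall>a\<in>dp p. seq_conv a b \<in> dp p}"

text \<open>The supremum is a real one: for \<open>p \<ge> 1\<close> and \<open>b \<in> dp_mult p\<close> it is taken over a nonempty set
  that is bounded by the closed graph theorem. For other \<open>b\<close> the value carries no meaning.\<close>

definition dp_mult_norm :: "real \<Rightarrow> (nat \<Rightarrow> complex) \<Rightarrow> real" where
  "dp_mult_norm p b = (SUP a\<in>dp p - {\<lambda>_. 0}. dp_norm p (seq_conv a b) / dp_norm p a)"

definition ell1 :: "(nat \<Rightarrow> complex) set" where
  "ell1 = {b. summable (\<lambda>n. cmod (b n))}"

definition ell1_norm :: "(nat \<Rightarrow> complex) \<Rightarrow> real" where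
  "ell1_norm b = (\<Sum>n. cmod (b n))"

text \<open>The topology induced on the sequence space \<open>X\<close> by a norm \<open>N\<close> on \<open>X\<close>. The locale
  \<open>Metric_space\<close> asks for nonnegativity and symmetry of the distance on the whole type, so the
  distance is set to \<open>0\<close> off \<open>X\<close>, where \<open>N\<close> may be meaningless; these values do not affect the
  topology.\<close>

definition norm_dist ::
  "(nat \<Rightarrow> complex) set \<Rightarrow> ((nat \<Rightarrow> complex) \<Rightarrow> real) \<Rightarrow> (nat \<Rightarrow> complex) \<Rightarrow> (nat \<Rightarrow> complex) \<Rightarrow> real"
  where "norm_dist X N a b = (if a \<in> X \<and> b \<in> X then N (\<lambda>n. a n - b n) else 0)"

definition norm_topology ::
  "(nat \<Rightarrow> complex) set \<Rightarrow> ((nat \<Rightarrow> complex) \<Rightarrow> real) \<Rightarrow> (nat \<Rightarrow> complex) topology" where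
  "norm_topology X N = Metric_space.mtopology X (norm_dist X N)"

end

theory Submission
  imports Defs
begin

text \<open>
  The inclusion is a contraction. Let \<open>b\<close> be a multiplier of \<open>d\<^sub>p\<close> and let \<open>a\<close> be supported on
  \<open>0, \<dots>, N\<close> with \<open>a\<^sub>j\<close> the conjugate phase of \<open>b\<close> at \<open>N - j\<close>. Then \<open>(a * b)\<close> at \<open>N\<close> equals
  \<open>\<bar>b\<^sub>0\<bar> + \<dots> + \<bar>b\<^sub>N\<bar>\<close>. An entry at \<open>N\<close> occurs in each of the \<open>N + 1\<close> tails that start at \<open>0, \<dots>, N\<close>, so
  this number times \<open>(N + 1)\<^bsup>1/p\<^esup>\<close> is at most \<open>\<parallel>a * b\<parallel> \<le> \<parallel>b\<parallel> \<parallel>a\<parallel> \<le> \<parallel>b\<parallel> (N + 1)\<^bsup>1/p\<^esup>\<close>, where \<open>\<parallel>b\<parallel>\<close> is the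
  multiplier norm. Cancelling the powers and letting \<open>N\<close> grow gives \<open>\<parallel>b\<parallel>\<^sub>1 \<le> \<parallel>b\<parallel>\<close>. This is
  \<open>partial_sum_le_dp_mult_norm\<close>.

  The estimate \<open>\<parallel>a * b\<parallel> \<le> \<parallel>b\<parallel> \<parallel>a\<parallel>\<close> presupposes that the supremum defining \<open>\<parallel>b\<parallel>\<close> is finite, whereas
  a multiplier is only required to map \<open>d\<^sub>p\<close> into itself. Finiteness (\<open>dp_mult_bounded\<close>) is an
  instance of the closed graph theorem and is derived from Baire's theorem. The ingredients are that
  \<open>d\<^sub>p\<close> is a complete normed space, where the triangle inequality follows from convexity of the
  \<open>p\<close>-th power (\<open>dp_sum_add_le\<close>) and completeness from a Fatou property (\<open>dp_sum_fatou\<close>).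

  Contractivity yields continuity once both norms are known to induce metrics; for the multiplier
  norm the definiteness follows again from \<open>\<parallel>b\<parallel>\<^sub>1 \<le> \<parallel>b\<parallel>\<close>.
\<close>

section \<open>The norm of the sequence space\<close>

text \<open>Entries of sequences may vanish, so convexity of the power is needed on the closed half-line; at
  the boundary point it reduces to \<open>t powr p \<le> t\<close>.\<close>

lemma powr_convex_nonneg:
  fixes x y t p :: real
  assumes "1 \<le> p" "0 \<le> x" "0 \<le> y" "0 < t" "t < 1"
  shows "((1 - t) * x + t * y) powr p \<le> (1 - t) * x powr p + t * y powr p"
proof -
  have scale: "(s * z) powr p \<le> s * z powr p" if "0 < s" "s < 1" "0 \<le> z" for s z :: real
  proof -
    have "s powr p \<le> s powr 1"
      using that assms by (intro powr_mono') auto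
    then show ?thesis
      using that by (simp add: powr_mult mult_right_mono)
  qed
  show ?thesis
  proof (cases "x = 0 \<or> y = 0")
    case True
    then show ?thesis
      using scale[of t y] scale[of "1 - t" x] assms by auto
  next
    case False
    then show ?thesis
      using convex_onD[OF powr_convex[OF assms(1)], of t x y] assms by auto
  qed
qed

lemma dp_sum_cmult:
  "dp_sum p (\<lambda>k. c * a k) = ennreal (cmod c powr p) * dp_sum p a"
  by (simp add: dp_sum_def norm_mult powr_mult ennreal_mult' flip: SUP_mult_left_ennreal)

lemma dp_sum_minus: "dp_sum p (\<lambda>k. - a k) = dp_sum p a"
  by (simp add: dp_sum_def)

lemma dp_sum_zero: "dp_sum p (\<lambda>k. 0) = 0"
  by (simp add: dp_sum_def)

text \<open>Minkowski's inequality for \<open>d\<^sub>p\<close>, in the form "the gauge of the unit ball is subadditive".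
  Convexity with the weights \<open>r / (r + s)\<close> and \<open>s / (r + s)\<close> bounds \<open>\<bar>a\<^sub>k + b\<^sub>k\<bar>\<^sup>p\<close>, for each index
  separately, by a fixed combination of \<open>\<bar>a\<^sub>k\<bar>\<^sup>p\<close> and \<open>\<bar>b\<^sub>k\<bar>\<^sup>p\<close>; such a bound survives suprema over
  tails and summation.\<close>

lemma dp_sum_add_le:
  assumes p: "1 \<le> p" and pos: "0 < r" "0 < s"
    and a: "dp_sum p a \<le> ennreal (r powr p)" and b: "dp_sum p b \<le> ennreal (s powr p)"
  shows "dp_sum p (\<lambda>k. a k + b k) \<le> ennreal ((r + s) powr p)"
proof -
  define t where "t = s / (r + s)"
  have t: "0 < t" "t < 1" "1 - t = r / (r + s)"
    using pos by (auto simp: t_def field_simps)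
  define A where "A = (r + s) powr p * ((1 - t) / r powr p)"
  define B where "B = (r + s) powr p * (t / s powr p)"
  have AB: "0 \<le> A" "0 \<le> B"
    using t(1,2) unfolding A_def B_def by (intro mult_nonneg_nonneg divide_nonneg_nonneg; simp)+
  have ptw: "cmod (a k + b k) powr p \<le> A * cmod (a k) powr p + B * cmod (b k) powr p" for k
  proof -
    have "cmod (a k + b k) \<le> cmod (a k) + cmod (b k)"
      by (rule norm_triangle_ineq)
    also have "\<dots> = (r + s) * ((1 - t) * (cmod (a k) / r) + t * (cmod (b k) / s))"
    proof -
      have "(1 - t) * (cmod (a k) / r) = cmod (a k) / (r + s)"
        and "t * (cmod (b k) / s) = cmod (b k) / (r + s)"
        using pos by (simp_all only: t(3)) (simp_all add: t_def)
      then show ?thesis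
        using pos by (simp only:) (simp flip: add_divide_distrib)
    qed
    finally have "cmod (a k + b k) powr p
        \<le> ((r + s) * ((1 - t) * (cmod (a k) / r) + t * (cmod (b k) / s))) powr p"
      using p by (intro powr_mono2) auto
    also have "\<dots> = (r + s) powr p * ((1 - t) * (cmod (a k) / r) + t * (cmod (b k) / s)) powr p"
      by (simp add: powr_mult)
    also have "\<dots> \<le> (r + s) powr p *
        ((1 - t) * (cmod (a k) / r) powr p + t * (cmod (b k) / s) powr p)"
      using p pos t by (intro mult_left_mono powr_convex_nonneg) auto
    finally show ?thesis
      by (simp add: A_def B_def powr_divide algebra_simps)
  qed
  have "(SUP k\<in>{n..}. ennreal (cmod (a k + b k) powr p))
      \<le> ennreal A * (SUP k\<in>{n..}. ennreal (cmod (a k) powr p))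
        + ennreal B * (SUP k\<in>{n..}. ennreal (cmod (b k) powr p))" for n
  proof (rule SUP_least)
    fix k assume k: "k \<in> {n..}"
    have "ennreal (cmod (a k + b k) powr p)
        \<le> ennreal A * ennreal (cmod (a k) powr p) + ennreal B * ennreal (cmod (b k) powr p)"
      using ptw[of k] AB by (simp flip: ennreal_mult' ennreal_plus)
    also have "\<dots> \<le> ennreal A * (SUP k\<in>{n..}. ennreal (cmod (a k) powr p))
        + ennreal B * (SUP k\<in>{n..}. ennreal (cmod (b k) powr p))"
      using k by (intro add_mono mult_left_mono SUP_upper) auto
    finally show "ennreal (cmod (a k + b k) powr p)
        \<le> ennreal A * (SUP k\<in>{n..}. ennreal (cmod (a k) powr p))
          + ennreal B * (SUP k\<in>{n..}. ennreal (cmod (b k) powr p))" .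
  qed
  then have "dp_sum p (\<lambda>k. a k + b k)
      \<le> (\<Sum>n. ennreal A * (SUP k\<in>{n..}. ennreal (cmod (a k) powr p))
        + ennreal B * (SUP k\<in>{n..}. ennreal (cmod (b k) powr p)))"
    unfolding dp_sum_def by (intro suminf_le) auto
  also have "\<dots> = ennreal A * dp_sum p a + ennreal B * dp_sum p b"
    unfolding dp_sum_def by (subst suminf_add[symmetric]) auto
  also have "\<dots> \<le> ennreal A * ennreal (r powr p) + ennreal B * ennreal (s powr p)"
    using a b by (intro add_mono mult_left_mono) auto
  also have "\<dots> = ennreal (A * r powr p + B * s powr p)"
    using AB by (simp add: ennreal_mult')
  also have "A * r powr p + B * s powr p = (r + s) powr p"
    using pos by (simp add: A_def B_def field_simps)
  finally show ?thesis .
qed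

text \<open>A single entry \<open>a\<^sub>k\<close> lies in the tails starting at \<open>0, \<dots>, k\<close>, so it is counted \<open>k + 1\<close> times.
  This repetition is what makes the multiplier norm dominate the \<open>\<ell>\<^sup>1\<close> norm.\<close>

lemma dp_sum_lower_bound: "ennreal (real (Suc k) * cmod (a k) powr p) \<le> dp_sum p a"
proof -
  have "ennreal (real (Suc k) * cmod (a k) powr p) = (\<Sum>n<Suc k. ennreal (cmod (a k) powr p))"
    by (simp add: ennreal_mult' ennreal_of_nat_eq_real_of_nat del: of_nat_Suc)
  also have "\<dots> \<le> (\<Sum>n<Suc k. SUP k\<in>{n..}. ennreal (cmod (a k) powr p))"
    by (intro sum_mono SUP_upper) auto
  also have "\<dots> \<le> dp_sum p a"
    unfolding dp_sum_def by (rule sum_le_suminf) auto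
  finally show ?thesis .
qed

text \<open>Balls of \<open>d\<^sub>p\<close> are closed under pointwise limits: a supremum of limits inferior is at most the
  limit inferior of the suprema, and then Fatou's lemma applies to counting measure. Completeness
  of \<open>d\<^sub>p\<close> and the closedness needed for Baire's theorem both come from here.\<close>

lemma dp_sum_fatou:
  assumes p: "0 < p" and lim: "\<And>k. (\<lambda>i. x i k) \<longlonglongrightarrow> a k"
    and C: "\<forall>\<^sub>F i in sequentially. dp_sum p (x i) \<le> C"
  shows "dp_sum p a \<le> C"
proof -
  define g where "g i n = (SUP k\<in>{n..}. ennreal (cmod (x i k) powr p))" for i n
  have "(SUP k\<in>{n..}. ennreal (cmod (a k) powr p)) \<le> liminf (\<lambda>i. g i n)" for n
  proof (rule SUP_least)
    fix k assume k: "k \<in> {n..}"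
    have "(\<lambda>i. cmod (x i k) powr p) \<longlonglongrightarrow> cmod (a k) powr p"
      using p lim by (intro tendsto_powr' tendsto_norm tendsto_const) auto
    then have "ennreal (cmod (a k) powr p) = liminf (\<lambda>i. ennreal (cmod (x i k) powr p))"
      by (intro lim_imp_Liminf[symmetric] tendsto_ennrealI) auto
    also have "\<dots> \<le> liminf (\<lambda>i. g i n)"
      unfolding g_def using k by (intro Liminf_mono always_eventually allI SUP_upper)
    finally show "ennreal (cmod (a k) powr p) \<le> liminf (\<lambda>i. g i n)" .
  qed
  then have "dp_sum p a \<le> (\<Sum>n. liminf (\<lambda>i. g i n))"
    unfolding dp_sum_def by (intro suminf_le) auto
  also have "\<dots> \<le> liminf (\<lambda>i. \<Sum>n. g i n)"
    using nn_integral_liminf[of g "count_space UNIV"]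
    by (simp add: nn_integral_count_space_nat)
  also have "\<dots> = liminf (\<lambda>i. dp_sum p (x i))"
    by (simp add: dp_sum_def g_def)
  also have "\<dots> \<le> C"
    using C by (intro Liminf_le) auto
  finally show ?thesis .
qed

lemma dp_norm_nonneg: "0 \<le> dp_norm p a"
  by (simp add: dp_norm_def)

lemma dp_sum_eq_dp_norm:
  assumes "0 < p" "a \<in> dp p"
  shows "dp_sum p a = ennreal (dp_norm p a powr p)"
  using assms by (simp add: dp_norm_def dp_def powr_powr)

text \<open>Translates between the extended-valued sum, for which no finiteness has to be tracked, and the
  real norm, which is meaningful only for members of \<open>d\<^sub>p\<close>.\<close>

lemma dp_sum_le_iff:
  assumes p: "0 < p" and c: "0 \<le> c"
  shows "dp_sum p a \<le> ennreal (c powr p) \<longleftrightarrow> a \<in> dp p \<and> dp_norm p a \<le> c"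
proof -
  have "a \<in> dp p" if "dp_sum p a \<le> ennreal (c powr p)"
    using that ennreal_less_top le_less_trans by (fastforce simp: dp_def)
  moreover have "dp_norm p a powr p \<le> c powr p \<longleftrightarrow> dp_norm p a \<le> c"
    using powr_less_mono2[OF p c, of "dp_norm p a"] powr_mono2[of p "dp_norm p a" c] p
    by (auto simp: dp_norm_nonneg not_le[symmetric])
  ultimately show ?thesis
    using dp_sum_eq_dp_norm[OF p] by auto
qed

lemma dp_cmult:
  assumes p: "0 < p" and a: "a \<in> dp p"
  shows "(\<lambda>k. c * a k) \<in> dp p" "dp_norm p (\<lambda>k. c * a k) = cmod c * dp_norm p a"
  using p a by (auto simp: dp_def dp_norm_def dp_sum_cmult ennreal_mult_less_top
      enn2real_mult powr_mult powr_powr)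

lemma dp_minus:
  assumes "a \<in> dp p"
  shows "(\<lambda>k. - a k) \<in> dp p" "dp_norm p (\<lambda>k. - a k) = dp_norm p a"
  using assms by (auto simp: dp_def dp_norm_def dp_sum_minus)

lemma dp_add:
  assumes p: "1 \<le> p" and "a \<in> dp p" "b \<in> dp p"
  shows "(\<lambda>k. a k + b k) \<in> dp p" "dp_norm p (\<lambda>k. a k + b k) \<le> dp_norm p a + dp_norm p b"
proof -
  \<comment> \<open>The gauge form of Minkowski's inequality needs positive radii, hence the slack \<open>e\<close>.\<close>
  have *: "(\<lambda>k. a k + b k) \<in> dp p \<and>
      dp_norm p (\<lambda>k. a k + b k) \<le> (dp_norm p a + e / 2) + (dp_norm p b + e / 2)" if "0 < e" for e
  proof -
    have pos: "0 < dp_norm p a + e / 2" "0 < dp_norm p b + e / 2"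
      using that dp_norm_nonneg[of p a] dp_norm_nonneg[of p b] by linarith+
    show ?thesis
      using dp_sum_add_le[OF p pos, of a b] assms that pos by (auto simp: dp_sum_le_iff)
  qed
  show "(\<lambda>k. a k + b k) \<in> dp p"
    using *[of 1] by simp
  show "dp_norm p (\<lambda>k. a k + b k) \<le> dp_norm p a + dp_norm p b"
  proof (rule field_le_epsilon)
    show "dp_norm p (\<lambda>k. a k + b k) \<le> dp_norm p a + dp_norm p b + e" if "0 < e" for e
      using *[OF that] by simp
  qed
qed

lemma dp_diff:
  assumes p: "1 \<le> p" and "a \<in> dp p" "b \<in> dp p"
  shows "(\<lambda>k. a k - b k) \<in> dp p"
  using dp_add(1)[OF p assms(2) dp_minus(1)[OF assms(3)]] by simp

lemma dp_norm_lower_bound: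
  assumes p: "0 < p" and a: "a \<in> dp p"
  shows "real (Suc k) powr (1 / p) * cmod (a k) \<le> dp_norm p a"
proof -
  have "real (Suc k) * cmod (a k) powr p \<le> dp_norm p a powr p"
    using dp_sum_lower_bound[of k a p] dp_sum_eq_dp_norm[OF assms] by simp
  then have "(real (Suc k) * cmod (a k) powr p) powr (1 / p) \<le> (dp_norm p a powr p) powr (1 / p)"
    using p by (intro powr_mono2) auto
  then show ?thesis
    using p by (simp add: powr_mult powr_powr dp_norm_nonneg)
qed

lemma norm_le_dp_norm:
  assumes p: "0 < p" and a: "a \<in> dp p"
  shows "cmod (a k) \<le> dp_norm p a"
proof -
  have "1 * cmod (a k) \<le> real (Suc k) powr (1 / p) * cmod (a k)"
    using p by (intro mult_right_mono ge_one_powr_ge_zero) auto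
  then show ?thesis
    using dp_norm_lower_bound[OF assms, of k] by linarith
qed

lemma dp_norm_eq_0:
  assumes "0 < p" "a \<in> dp p" "dp_norm p a = 0"
  shows "a = (\<lambda>_. 0)"
  using norm_le_dp_norm[OF assms(1,2)] assms(3) by auto

lemma dp_norm_pos:
  assumes "0 < p" "a \<in> dp p" "a \<noteq> (\<lambda>_. 0)"
  shows "0 < dp_norm p a"
  using dp_norm_eq_0[OF assms(1,2)] assms(3) dp_norm_nonneg[of p a] by force

lemma dp_zero: "(\<lambda>_. 0) \<in> dp p" "dp_norm p (\<lambda>_. 0) = 0"
  by (auto simp: dp_def dp_norm_def dp_sum_zero)

section \<open>The norm topologies\<close>

lemma Metric_space_norm_dist:
  assumes diff: "\<And>a b. a \<in> X \<Longrightarrow> b \<in> X \<Longrightarrow> (\<lambda>n. a n - b n) \<in> X"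
    and nonneg: "\<And>a. a \<in> X \<Longrightarrow> 0 \<le> N a"
    and zero: "N (\<lambda>_. 0) = 0"
    and definite: "\<And>a. a \<in> X \<Longrightarrow> N a = 0 \<Longrightarrow> a = (\<lambda>_. 0)"
    and minus: "\<And>a. a \<in> X \<Longrightarrow> N (\<lambda>n. - a n) = N a"
    and add: "\<And>a b. a \<in> X \<Longrightarrow> b \<in> X \<Longrightarrow> N (\<lambda>n. a n + b n) \<le> N a + N b"
  shows "Metric_space X (norm_dist X N)"
proof
  fix a b c
  show "0 \<le> norm_dist X N a b"
    by (simp add: norm_dist_def nonneg diff)
  show "norm_dist X N a b = norm_dist X N b a"
    using minus[OF diff, of a b] by (simp add: norm_dist_def)
  show "norm_dist X N a b = 0 \<longleftrightarrow> a = b" if "a \<in> X" "b \<in> X"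
    using that definite[OF diff, of a b] by (auto simp: norm_dist_def zero fun_eq_iff)
  show "norm_dist X N a c \<le> norm_dist X N a b + norm_dist X N b c"
    if "a \<in> X" "b \<in> X" "c \<in> X"
    using that add[OF diff diff, of a b b c] by (simp add: norm_dist_def)
qed

lemma Metric_space_dp:
  assumes "1 \<le> p"
  shows "Metric_space (dp p) (norm_dist (dp p) (dp_norm p))"
proof (rule Metric_space_norm_dist)
  show "a = (\<lambda>_. 0)" if "a \<in> dp p" "dp_norm p a = 0" for a
    using assms that by (intro dp_norm_eq_0[of p]) auto
qed (use assms in \<open>simp_all add: dp_diff dp_norm_nonneg dp_zero dp_minus dp_add\<close>)

text \<open>A Cauchy sequence converges pointwise because \<open>\<bar>a\<^sub>k\<bar> \<le> \<parallel>a\<parallel>\<close>, and the Cauchy estimate passes to the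
  pointwise limit because balls are closed under pointwise limits.\<close>

lemma mcomplete_dp:
  assumes p: "1 \<le> p"
  shows "Metric_space.mcomplete (dp p) (norm_dist (dp p) (dp_norm p))"
proof -
  interpret dp: Metric_space "dp p" "norm_dist (dp p) (dp_norm p)"
    using p by (rule Metric_space_dp)
  have p0: "0 < p"
    using p by simp
  show ?thesis
    unfolding dp.mcomplete_def
  proof (intro allI impI)
    fix x assume "dp.MCauchy x"
    then have x: "x i \<in> dp p" for i
      by (auto simp: dp.MCauchy_def)
    have cauchy: "\<exists>N. \<forall>i\<ge>N. \<forall>j\<ge>N. dp_norm p (\<lambda>k. x i k - x j k) < e" if "0 < e" for e
      using \<open>dp.MCauchy x\<close> that x unfolding dp.MCauchy_def norm_dist_def by simp
    have "convergent (\<lambda>i. x i k)" for k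
    proof (rule Cauchy_convergent, rule metric_CauchyI)
      fix e :: real assume "0 < e"
      then obtain N where N: "\<forall>i\<ge>N. \<forall>j\<ge>N. dp_norm p (\<lambda>k. x i k - x j k) < e"
        using cauchy by blast
      have "dist (x i k) (x j k) < e" if "N \<le> i" "N \<le> j" for i j
        using norm_le_dp_norm[OF p0 dp_diff[OF p x[of i] x[of j]], of k] N that
        by (fastforce simp: dist_norm)
      then show "\<exists>N. \<forall>i\<ge>N. \<forall>j\<ge>N. dist (x i k) (x j k) < e"
        by blast
    qed
    then obtain l where l: "\<And>k. (\<lambda>i. x i k) \<longlonglongrightarrow> l k"
      unfolding convergent_def by metis
    have close: "\<exists>N. \<forall>i\<ge>N. (\<lambda>k. x i k - l k) \<in> dp p \<and> dp_norm p (\<lambda>k. x i k - l k) \<le> e"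
      if e: "0 < e" for e
    proof -
      obtain N where N: "\<forall>i\<ge>N. \<forall>j\<ge>N. dp_norm p (\<lambda>k. x i k - x j k) < e"
        using cauchy e by blast
      have "dp_sum p (\<lambda>k. x i k - l k) \<le> ennreal (e powr p)" if i: "N \<le> i" for i
      proof (rule dp_sum_fatou[OF p0])
        show "(\<lambda>j. x i k - x j k) \<longlonglongrightarrow> x i k - l k" for k
          by (intro tendsto_diff tendsto_const l)
        show "\<forall>\<^sub>F j in sequentially. dp_sum p (\<lambda>k. x i k - x j k) \<le> ennreal (e powr p)"
          unfolding eventually_sequentially
        proof (intro exI allI impI)
          fix j assume "N \<le> j"
          then show "dp_sum p (\<lambda>k. x i k - x j k) \<le> ennreal (e powr p)"
            using N i e p0 dp_diff[OF p x x] by (simp add: dp_sum_le_iff less_imp_le)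
        qed
      qed
      then show ?thesis
        using p0 e by (auto simp: dp_sum_le_iff)
    qed
    have "l \<in> dp p"
    proof -
      obtain i where "(\<lambda>k. x i k - l k) \<in> dp p"
        using close[of 1] by auto
      then show ?thesis
        using dp_diff[OF p x[of i]] by fastforce
    qed
    moreover have "\<exists>N. \<forall>i\<ge>N. dp_norm p (\<lambda>k. x i k - l k) < e" if "0 < e" for e
      using close[of "e / 2"] that by (metis field_sum_of_halves half_gt_zero le_less_trans
          less_add_same_cancel2)
    ultimately show "\<exists>l. limitin dp.mtopology x l sequentially"
      using x by (auto simp: dp.limit_metric_sequentially norm_dist_def)
  qed
qed

section \<open>Boundedness of multipliers\<close>

lemma seq_conv_add_left: "seq_conv (\<lambda>k. a k + a' k) b = (\<lambda>n. seq_conv a b n + seq_conv a' b n)"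
  by (simp add: seq_conv_def fun_eq_iff sum.distrib algebra_simps)

lemma seq_conv_cmult_left: "seq_conv (\<lambda>k. c * a k) b = (\<lambda>n. c * seq_conv a b n)"
  by (simp add: seq_conv_def fun_eq_iff sum_distrib_left algebra_simps)

lemma seq_conv_add_right: "seq_conv a (\<lambda>k. b k + b' k) = (\<lambda>n. seq_conv a b n + seq_conv a b' n)"
  by (simp add: seq_conv_def fun_eq_iff sum.distrib algebra_simps)

lemma seq_conv_minus_right: "seq_conv a (\<lambda>k. - b k) = (\<lambda>n. - seq_conv a b n)"
  by (simp add: seq_conv_def fun_eq_iff sum_negf)

lemma seq_conv_zero: "seq_conv (\<lambda>_. 0) b = (\<lambda>_. 0)" "seq_conv a (\<lambda>_. 0) = (\<lambda>_. 0)"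
  by (simp_all add: seq_conv_def fun_eq_iff)

text \<open>The closed graph theorem for convolution with \<open>b\<close>. The sets \<open>F m\<close> of those \<open>a\<close> with
  \<open>\<parallel>a * b\<parallel> \<le> m\<close> exhaust \<open>d\<^sub>p\<close>. They are closed, because each entry of \<open>a * b\<close> involves only finitely
  many entries of \<open>a\<close>, so that convergence in \<open>d\<^sub>p\<close> of the first factor makes the convolutions
  converge pointwise, and balls are closed under pointwise limits. By Baire's theorem some
  \<open>F m\<close> contains a ball, and translating that ball to the origin and rescaling gives a bound on all of \<open>d\<^sub>p\<close>.\<close>

lemma dp_mult_bounded:
  assumes p: "1 \<le> p" and b: "b \<in> dp_mult p"
  obtains K where "\<And>a. a \<in> dp p \<Longrightarrow> dp_norm p (seq_conv a b) \<le> K * dp_norm p a"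
proof -
  interpret dp: Metric_space "dp p" "norm_dist (dp p) (dp_norm p)"
    using p by (rule Metric_space_dp)
  have p0: "0 < p"
    using p by simp
  have conv: "seq_conv a b \<in> dp p" if "a \<in> dp p" for a
    using b that by (auto simp: dp_mult_def)
  define F where "F m = {a \<in> dp p. dp_norm p (seq_conv a b) \<le> real m}" for m
  have closed: "closedin dp.mtopology (F m)" for m
    unfolding dp.metric_closedin_iff_sequentially_closed
  proof (intro conjI allI impI)
    show "F m \<subseteq> dp p"
      by (auto simp: F_def)
    fix x l assume "range x \<subseteq> F m \<and> limitin dp.mtopology x l sequentially"
    then have x: "\<And>i. x i \<in> F m" and l: "l \<in> dp p"
      and lim: "\<And>e. 0 < e \<Longrightarrow> \<exists>N. \<forall>i\<ge>N. norm_dist (dp p) (dp_norm p) (x i) l < e"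
      unfolding dp.limit_metric_sequentially by blast+
    have xdp: "x i \<in> dp p" for i
      using x by (auto simp: F_def)
    have "(\<lambda>i. x i k) \<longlonglongrightarrow> l k" for k
    proof (rule metric_LIMSEQ_I)
      fix e :: real assume "0 < e"
      then obtain N where N: "\<forall>i\<ge>N. dp_norm p (\<lambda>k. x i k - l k) < e"
        using lim[OF \<open>0 < e\<close>] xdp l unfolding norm_dist_def by auto
      have "dist (x i k) (l k) < e" if "N \<le> i" for i
        unfolding dist_norm
        using norm_le_dp_norm[OF p0 dp_diff[OF p xdp[of i] l], of k] N[rule_format, OF that]
        by (rule le_less_trans)
      then show "\<exists>N. \<forall>i\<ge>N. dist (x i k) (l k) < e"
        by blast
    qed
    then have "(\<lambda>i. seq_conv (x i) b n) \<longlonglongrightarrow> seq_conv l b n" for n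
      unfolding seq_conv_def by (intro tendsto_sum tendsto_mult tendsto_const)
    moreover have "dp_sum p (seq_conv (x i) b) \<le> ennreal (real m powr p)" for i
      using x[of i] p0 conv by (auto simp: dp_sum_le_iff F_def)
    ultimately have "dp_sum p (seq_conv l b) \<le> ennreal (real m powr p)"
      by (intro dp_sum_fatou[OF p0, of "\<lambda>i. seq_conv (x i) b"]) auto
    then show "l \<in> F m"
      using p0 l by (auto simp: dp_sum_le_iff F_def)
  qed
  have "(\<Union>m. F m) = dp p"
    using real_arch_simple by (auto simp: F_def)
  then have "dp.mtopology interior_of (\<Union>m. F m) \<noteq> {}"
    using interior_of_topspace[of dp.mtopology] dp_zero(1)[of p]
    unfolding dp.topspace_mtopology by (simp only:) blast
  moreover have "dp.mtopology interior_of (\<Union>m. F m) = {}"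
    if "\<And>m. dp.mtopology interior_of F m = {}"
    by (rule dp.metric_Baire_category_alt[OF mcomplete_dp[OF p]]) (use closed that in auto)
  ultimately obtain m where "dp.mtopology interior_of F m \<noteq> {}"
    by blast
  then obtain c where c: "c \<in> dp.mtopology interior_of F m"
    by blast
  from c obtain r where r: "0 < r" "dp.mball c r \<subseteq> F m"
    using openin_interior_of[of dp.mtopology "F m"] interior_of_subset[of dp.mtopology "F m"]
    unfolding dp.openin_mtopology by (meson subset_trans)
  have c: "c \<in> dp p"
    using c interior_of_subset[of dp.mtopology "F m"] unfolding F_def by blast
  have small: "dp_norm p (seq_conv a b) \<le> 2 * real m" if a: "a \<in> dp p" "dp_norm p a < r" for a
  proof -
    have ca: "(\<lambda>k. c k + a k) \<in> dp p"
      using p c a(1) by (rule dp_add)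
    have "norm_dist (dp p) (dp_norm p) c (\<lambda>k. c k + a k) < r"
      using a c ca by (simp add: norm_dist_def dp_minus)
    then have "(\<lambda>k. c k + a k) \<in> F m" and "c \<in> F m"
      using subsetD[OF r(2)] r(1) c ca by simp_all
    then have 1: "dp_norm p (seq_conv (\<lambda>k. c k + a k) b) \<le> real m"
      and 2: "dp_norm p (seq_conv c b) \<le> real m"
      by (simp_all add: F_def)
    have "seq_conv a b = (\<lambda>n. seq_conv (\<lambda>k. c k + a k) b n + - seq_conv c b n)"
      by (simp add: seq_conv_add_left)
    then have "dp_norm p (seq_conv a b)
        \<le> dp_norm p (seq_conv (\<lambda>k. c k + a k) b) + dp_norm p (\<lambda>n. - seq_conv c b n)"
      using dp_add(2)[OF p conv[OF ca] dp_minus(1)[OF conv[OF c]]] by simp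
    then show ?thesis
      using 1 2 conv[OF c] by (simp add: dp_minus)
  qed
  have "dp_norm p (seq_conv a b) \<le> (4 * real m / r) * dp_norm p a" if a: "a \<in> dp p" for a
  proof (cases "dp_norm p a = 0")
    case True
    then have "a = (\<lambda>_. 0)"
      using p0 a by (intro dp_norm_eq_0)
    then show ?thesis
      by (simp add: seq_conv_zero dp_zero)
  next
    case False
    then have pos: "0 < dp_norm p a"
      using dp_norm_nonneg[of p a] by linarith
    \<comment> \<open>The factor \<open>2\<close> makes \<open>s a\<close> have norm \<open>r / 2\<close>, strictly inside the open ball.\<close>
    define s where "s = r / (2 * dp_norm p a)"
    have s: "0 < s" "s * dp_norm p a = r / 2"
      using pos r by (simp_all add: s_def)
    have "dp_norm p (\<lambda>k. of_real s * a k) < r"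
      using dp_cmult(2)[OF p0 a, of "of_real s"] s r by simp
    then have "s * dp_norm p (seq_conv a b) \<le> 2 * real m"
      using small[OF dp_cmult(1)[OF p0 a, of "of_real s"]]
        dp_cmult(2)[OF p0 conv[OF a], of "of_real s"] s
      by (simp add: seq_conv_cmult_left)
    then show ?thesis
      using pos r by (simp add: s_def field_simps)
  qed
  then show ?thesis
    by (rule that)
qed

section \<open>The multiplier norm\<close>

text \<open>A nonzero member of \<open>d\<^sub>p\<close>, so that the supremum defining the multiplier norm is over a
  nonempty set.\<close>

definition delta :: "nat \<Rightarrow> complex" where
  "delta k = (if k = 0 then 1 else 0)"

lemma delta_in_dp: "delta \<in> dp p - {\<lambda>_. 0}"
proof -
  have "(SUP k\<in>{n..}. ennreal (cmod (delta k) powr p)) = (if n = 0 then 1 else 0)" for n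
    by (auto simp: delta_def intro!: antisym SUP_least SUP_upper2[of 0])
  then have "dp_sum p delta = (\<Sum>n. if n = 0 then 1 else 0)"
    by (simp add: dp_sum_def)
  also have "\<dots> = 1"
    using suminf_finite[of "{0}" "\<lambda>n::nat. if n = 0 then 1 else 0 :: ennreal"] by simp
  finally have "delta \<in> dp p"
    by (simp add: dp_def)
  moreover have "delta \<noteq> (\<lambda>_. 0)"
    by (auto simp: delta_def fun_eq_iff)
  ultimately show ?thesis
    by simp
qed

text \<open>Boundedness of the multiplier makes the real supremum \<open>dp_mult_norm p b\<close> a genuine upper bound.\<close>

lemma dp_norm_seq_conv_le:
  assumes p: "1 \<le> p" and b: "b \<in> dp_mult p" and a: "a \<in> dp p"
  shows "dp_norm p (seq_conv a b) \<le> dp_mult_norm p b * dp_norm p a"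
proof (cases "a = (\<lambda>_. 0)")
  case True
  then show ?thesis
    by (simp add: seq_conv_zero dp_zero)
next
  case False
  have pos: "0 < dp_norm p a'" if "a' \<in> dp p - {\<lambda>_. 0}" for a'
    using that p by (intro dp_norm_pos) auto
  obtain K where K: "\<And>a. a \<in> dp p \<Longrightarrow> dp_norm p (seq_conv a b) \<le> K * dp_norm p a"
    using dp_mult_bounded[OF p b] by blast
  have "bdd_above ((\<lambda>a. dp_norm p (seq_conv a b) / dp_norm p a) ` (dp p - {\<lambda>_. 0}))"
    using K pos by (intro bdd_aboveI2[of _ _ K]) (simp add: pos_divide_le_eq)
  then have "dp_norm p (seq_conv a b) / dp_norm p a \<le> dp_mult_norm p b"
    unfolding dp_mult_norm_def using a False by (intro cSUP_upper) auto
  then show ?thesis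
    using pos[of a] a False by (simp add: pos_divide_le_eq)
qed

lemma dp_mult_norm_least:
  assumes p: "1 \<le> p" and K: "\<And>a. a \<in> dp p \<Longrightarrow> dp_norm p (seq_conv a b) \<le> K * dp_norm p a"
  shows "dp_mult_norm p b \<le> K"
  unfolding dp_mult_norm_def
proof (rule cSUP_least)
  show "dp p - {\<lambda>_. 0} \<noteq> {}"
    using delta_in_dp by blast
  fix a assume "a \<in> dp p - {\<lambda>_. 0}"
  then show "dp_norm p (seq_conv a b) / dp_norm p a \<le> K"
    using K[of a] p dp_norm_pos[of p a] by (simp add: pos_divide_le_eq)
qed

lemma dp_mult_norm_nonneg:
  assumes p: "1 \<le> p" and b: "b \<in> dp_mult p"
  shows "0 \<le> dp_mult_norm p b"
proof -
  have "0 < dp_norm p delta"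
    using delta_in_dp[of p] p by (intro dp_norm_pos) auto
  moreover have "0 \<le> dp_mult_norm p b * dp_norm p delta"
    using dp_norm_seq_conv_le[OF p b, of delta] delta_in_dp[of p]
      dp_norm_nonneg[of p "seq_conv delta b"] by simp
  ultimately show ?thesis
    by (simp add: zero_le_mult_iff)
qed

section \<open>Comparison with the absolutely summable sequences\<close>

text \<open>Test on the sequence supported on \<open>0, \<dots>, N\<close> whose entries are the conjugate phases of the
  reversed \<open>b\<close>. No cancellation occurs in the entry of the convolution at \<open>N\<close>, which is the partial sum.
  The norm of the test sequence is at most \<open>(N + 1)\<^bsup>1/p\<^esup>\<close>, and an entry at \<open>N\<close> contributes at least
  \<open>(N + 1)\<^bsup>1/p\<^esup>\<close> times its modulus to the norm of the convolution, so the two factors cancel.\<close>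

lemma partial_sum_le_dp_mult_norm:
  assumes p: "1 \<le> p" and b: "b \<in> dp_mult p"
  shows "(\<Sum>j\<le>N. cmod (b j)) \<le> dp_mult_norm p b"
proof -
  have p0: "0 < p"
    using p by simp
  define w where "w = real (Suc N) powr (1 / p)"
  have w: "0 < w"
    by (simp add: w_def)
  define a where "a j = (if j \<le> N then cnj (sgn (b (N - j))) else 0)" for j
  have "(SUP k\<in>{n..}. ennreal (cmod (a k) powr p)) \<le> (if n \<le> N then 1 else 0)" for n
    by (rule SUP_least) (auto simp: a_def norm_sgn)
  then have "dp_sum p a \<le> (\<Sum>n. if n \<le> N then 1 else 0 :: ennreal)"
    unfolding dp_sum_def by (intro suminf_le) auto
  also have "\<dots> = (\<Sum>n\<le>N. 1)"
    by (subst suminf_finite[of "{..N}"]) auto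
  also have "\<dots> = ennreal (w powr p)"
    using p0 by (simp add: w_def powr_powr ennreal_of_nat_eq_real_of_nat flip: of_nat_Suc)
  finally have a: "a \<in> dp p" "dp_norm p a \<le> w"
    using p0 w by (auto simp: dp_sum_le_iff)
  have phase: "cnj (sgn z) * z = of_real (cmod z)" for z
  proof -
    have "z * cnj z = of_real (cmod z) * of_real (cmod z)"
      using complex_norm_square[of z] by (simp add: power2_eq_square)
    then show ?thesis
      by (simp add: sgn_eq mult.commute)
  qed
  have "seq_conv a b N = (\<Sum>j=0..N. of_real (cmod (b (N - j))))"
    unfolding seq_conv_def by (intro sum.cong) (auto simp: a_def phase)
  also have "\<dots> = of_real (\<Sum>j\<le>N. cmod (b j))"
    using sum.atLeastAtMost_rev[of "\<lambda>j. complex_of_real (cmod (b j))" 0 N]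
    by (simp add: atMost_atLeast0)
  finally have "cmod (seq_conv a b N) = (\<Sum>j\<le>N. cmod (b j))"
    by (simp only: norm_of_real) (simp add: sum_nonneg)
  then have "w * (\<Sum>j\<le>N. cmod (b j)) \<le> dp_norm p (seq_conv a b)"
    using dp_norm_lower_bound[OF p0, of "seq_conv a b" N] b a by (auto simp: dp_mult_def w_def)
  also have "\<dots> \<le> dp_mult_norm p b * dp_norm p a"
    using p b a(1) by (rule dp_norm_seq_conv_le)
  also have "\<dots> \<le> dp_mult_norm p b * w"
    using a(2) dp_mult_norm_nonneg[OF p b] by (rule mult_left_mono)
  finally show ?thesis
    using w by (simp add: mult.commute)
qed

lemma dp_mult_ell1:
  assumes "1 \<le> p" and "b \<in> dp_mult p"
  shows "b \<in> ell1" "ell1_norm b \<le> dp_mult_norm p b"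
proof -
  have bound: "(\<Sum>j<n. cmod (b j)) \<le> dp_mult_norm p b" for n
  proof -
    have "(\<Sum>j<n. cmod (b j)) \<le> (\<Sum>j\<le>n. cmod (b j))"
      by (rule sum_mono2) auto
    then show ?thesis
      using partial_sum_le_dp_mult_norm[OF assms, of n] by linarith
  qed
  then have "summable (\<lambda>j. cmod (b j))"
    by (intro summableI_nonneg_bounded) auto
  then show "b \<in> ell1" "ell1_norm b \<le> dp_mult_norm p b"
    using bound by (auto simp: ell1_def ell1_norm_def intro: suminf_le_const)
qed

lemma Metric_space_ell1: "Metric_space ell1 (norm_dist ell1 ell1_norm)"
proof (rule Metric_space_norm_dist)
  fix a b assume ab: "a \<in> ell1" "b \<in> ell1"
  have sum: "summable (\<lambda>n. cmod (a n) + cmod (b n))"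
    using ab by (auto simp: ell1_def intro: summable_add)
  show "(\<lambda>n. a n - b n) \<in> ell1"
    using summable_comparison_test'[OF sum, of 0 "\<lambda>n. cmod (a n - b n)"]
    by (simp add: ell1_def norm_triangle_ineq4)
  have "summable (\<lambda>n. cmod (a n + b n))"
    using summable_comparison_test'[OF sum, of 0 "\<lambda>n. cmod (a n + b n)"]
    by (simp add: norm_triangle_ineq)
  then have "ell1_norm (\<lambda>n. a n + b n) \<le> (\<Sum>n. cmod (a n) + cmod (b n))"
    unfolding ell1_norm_def using sum by (intro suminf_le norm_triangle_ineq)
  also have "\<dots> = ell1_norm a + ell1_norm b"
    using ab by (simp add: ell1_def ell1_norm_def suminf_add)
  finally show "ell1_norm (\<lambda>n. a n + b n) \<le> ell1_norm a + ell1_norm b" .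
next
  show "a = (\<lambda>_. 0)" if "a \<in> ell1" "ell1_norm a = 0" for a
    using that by (auto simp: ell1_def ell1_norm_def suminf_eq_zero_iff)
qed (auto simp: ell1_def ell1_norm_def suminf_nonneg)

lemma dp_mult_diff:
  assumes p: "1 \<le> p" and bc: "b \<in> dp_mult p" "c \<in> dp_mult p"
  shows "(\<lambda>n. b n - c n) \<in> dp_mult p"
proof -
  have "seq_conv a (\<lambda>n. b n - c n) = (\<lambda>n. seq_conv a b n - seq_conv a c n)" for a
    using seq_conv_add_right[of a b "\<lambda>n. - c n"] by (simp add: seq_conv_minus_right)
  then show ?thesis
    using bc p by (simp add: dp_mult_def dp_diff)
qed

text \<open>The multiplier norm vanishes only at \<open>0\<close> because it dominates every partial sum of the \<open>\<bar>b\<^sub>j\<bar>\<close>.\<close>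

lemma Metric_space_dp_mult:
  assumes p: "1 \<le> p"
  shows "Metric_space (dp_mult p) (norm_dist (dp_mult p) (dp_mult_norm p))"
proof (rule Metric_space_norm_dist)
  show "0 \<le> dp_mult_norm p b" if "b \<in> dp_mult p" for b
    using p that by (rule dp_mult_norm_nonneg)
  have "(\<lambda>_. 0) \<in> dp_mult p"
    by (simp add: dp_mult_def seq_conv_zero dp_zero)
  then show "dp_mult_norm p (\<lambda>_. 0) = 0"
    using dp_mult_norm_least[OF p, of "\<lambda>_. 0" 0] dp_mult_norm_nonneg[OF p, of "\<lambda>_. 0"]
    by (simp add: seq_conv_zero dp_zero)
  show "b = (\<lambda>_. 0)" if b: "b \<in> dp_mult p" "dp_mult_norm p b = 0" for b
  proof
    fix n
    have "cmod (b n) \<le> (\<Sum>j\<le>n. cmod (b j))"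
      by (rule member_le_sum) auto
    also have "\<dots> \<le> 0"
      using partial_sum_le_dp_mult_norm[OF p b(1), of n] b(2) by simp
    finally show "b n = 0"
      by simp
  qed
  have "dp_norm p (seq_conv a (\<lambda>n. - b n)) = dp_norm p (seq_conv a b)"
    if "a \<in> dp p" "b \<in> dp_mult p" for a b
    using that by (simp add: seq_conv_minus_right dp_mult_def dp_minus)
  then show "dp_mult_norm p (\<lambda>n. - b n) = dp_mult_norm p b" if "b \<in> dp_mult p" for b
    using that by (simp add: dp_mult_norm_def)
  fix b c assume bc: "b \<in> dp_mult p" "c \<in> dp_mult p"
  show "(\<lambda>n. b n - c n) \<in> dp_mult p"
    using p bc by (rule dp_mult_diff)
  show "dp_mult_norm p (\<lambda>n. b n + c n) \<le> dp_mult_norm p b + dp_mult_norm p c"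
  proof (rule dp_mult_norm_least[OF p])
    fix a assume a: "a \<in> dp p"
    have "dp_norm p (seq_conv a (\<lambda>n. b n + c n))
        \<le> dp_norm p (seq_conv a b) + dp_norm p (seq_conv a c)"
      using bc a p by (simp add: seq_conv_add_right dp_mult_def dp_add)
    also have "\<dots> \<le> dp_mult_norm p b * dp_norm p a + dp_mult_norm p c * dp_norm p a"
      using bc a p by (intro add_mono dp_norm_seq_conv_le)
    finally show "dp_norm p (seq_conv a (\<lambda>n. b n + c n))
        \<le> (dp_mult_norm p b + dp_mult_norm p c) * dp_norm p a"
      by (simp add: distrib_right)
  qed
qed

theorem theorem4p2:
  fixes p :: real
  assumes "1 \<le> p"
  shows "dp_mult p \<subseteq> ell1 \<and>
    continuous_map (norm_topology (dp_mult p) (dp_mult_norm p)) (norm_topology ell1 ell1_norm)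
      (\<lambda>b. b)"
proof
  interpret mult: Metric_space "dp_mult p" "norm_dist (dp_mult p) (dp_mult_norm p)"
    using assms by (rule Metric_space_dp_mult)
  show sub: "dp_mult p \<subseteq> ell1"
    using dp_mult_ell1(1)[OF assms] by blast
  have "norm_dist ell1 ell1_norm b c \<le> norm_dist (dp_mult p) (dp_mult_norm p) b c"
    if "b \<in> dp_mult p" "c \<in> dp_mult p" for b c
  proof -
    have "(\<lambda>n. b n - c n) \<in> dp_mult p"
      using assms that by (rule dp_mult_diff)
    then show ?thesis
      using that sub dp_mult_ell1(2)[OF assms] by (auto simp: norm_dist_def)
  qed
  then show "continuous_map (norm_topology (dp_mult p) (dp_mult_norm p))
      (norm_topology ell1 ell1_norm) (\<lambda>b. b)"
    using sub unfolding norm_topology_def mult.metric_continuous_map[OF Metric_space_ell1]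
    by (auto intro: le_less_trans)
qed

end
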